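(* Let $n\ge 1$ and let $(\xi_i,\mathfrak{F}_i)_{i=0,\dots,n}$ be a sequence of real-valued martingale differences with $\xi_0=0$ and $\mathfrak F_0$ trivial, and let $S_n=\sum_{i=1}^n\xi_i$. If, for some $\beta\in(1,2)$, $\mathbb{E}|\xi_i|^\beta<\infty$ for all $i$, then for all $b>0$, $M\geq 1$ and $x>0$, \[ \mathbb{P}\Big(\frac{S_n}{\sqrt[\beta]{G_n(\beta)}}\geq x,\ b^{\frac{1}{\beta-1}}\leq \sqrt[\beta]{G_n(\beta)}\leq (bM)^{\frac{1}{\beta-1}}\Big) \leq \big(1+2(1+x)\ln M\big)\exp\Big\{-\Big(\frac{x}{\beta}\Big)^{\frac{\beta}{\beta-1}}\Big(1-\frac{1}{\beta}\Big)\Big\}. \]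
   Context: $(\Omega,\mathfrak F,\mathbb P)$ is a probability space with increasing $\sigma$-fields $\{\emptyset,\Omega\}=\mathfrak F_0\subseteq\cdots\subseteq\mathfrak F_n\subseteq\mathfrak F$; each $\xi_i$ is $\mathfrak F_i$-measurable and integrable with $\mathbb E[\xi_i\mid\mathfrak F_{i-1}]=0$ for $i\ge1$. With $\xi_i^{+}=\max\{\xi_i,0\}$ and $\xi_i^{-}=\max\{-\xi_i,0\}$, \[G_n(\beta)=\sum_{i=1}^{n}(\xi_i^{+})^\beta+\sum_{i=1}^{n}\mathbb{E}[(\xi_i^{-})^\beta|\mathfrak{F}_{i-1}].\] *)

theory Defs
  imports "HOL-Probability.Probability"
begin

definition martingale_differences ::
  "'a measure \<Rightarrow> nat \<Rightarrow> (nat \<Rightarrow> 'a measure) \<Rightarrow> (nat \<Rightarrow> 'a \<Rightarrow> real) \<Rightarrow> bool"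
where
  "martingale_differences P n F \<xi> \<longleftrightarrow>
     (\<forall>i\<le>n. subalgebra P (F i)) \<and>
     (\<forall>i j. i \<le> j \<and> j \<le> n \<longrightarrow> sets (F i) \<subseteq> sets (F j)) \<and>
     (\<forall>i\<le>n. \<xi> i \<in> borel_measurable (F i) \<and> integrable P (\<xi> i)) \<and>
     (\<forall>i\<in>{1..n}. AE \<omega> in P. real_cond_exp P (F (i - 1)) (\<xi> i) \<omega> = 0)"

definition partial_sum :: "nat \<Rightarrow> (nat \<Rightarrow> 'a \<Rightarrow> real) \<Rightarrow> 'a \<Rightarrow> real" where
  "partial_sum n \<xi> \<omega> = (\<Sum>i=1..n. \<xi> i \<omega>)"

(* real_cond_exp is one fixed version of the conditional expectation, so G_stat is determined
   everywhere but is nonnegative only almost everywhere. *)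
definition G_stat ::
  "'a measure \<Rightarrow> nat \<Rightarrow> (nat \<Rightarrow> 'a measure) \<Rightarrow> (nat \<Rightarrow> 'a \<Rightarrow> real) \<Rightarrow> real \<Rightarrow> 'a \<Rightarrow> real"
where
  "G_stat P n F \<xi> \<beta> \<omega> =
     (\<Sum>i=1..n. (max (\<xi> i \<omega>) 0) powr \<beta>) +
     (\<Sum>i=1..n. real_cond_exp P (F (i - 1)) (\<lambda>\<omega>'. (max (- \<xi> i \<omega>') 0) powr \<beta>) \<omega>)"

end

theory Submission
  imports Defs
begin

text \<open>
  Write \<open>e = \<beta> - 1\<close>, \<open>V = G_n(\<beta>)\<close> to the power \<open>1 / \<beta>\<close>, \<open>L = ln M\<close> and
  \<open>T = (x / \<beta>) powr (\<beta> / e)\<close>; the exponent to be reached is \<open>T * e / (1 + e)\<close>.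

  The engine is an exponential supermartingale. If \<open>exp (y - c * y\<^sub>+ powr \<beta>)\<close> is at most
  \<open>1 + y + c * y\<^sub>- powr \<beta>\<close> for all real \<open>y\<close> (\<open>exp_tilted_le_linear\<close>), then substituting
  \<open>y = l * \<xi>\<^sub>i\<close>, conditioning on the past and using \<open>1 + u \<le> exp u\<close> shows that
  \<open>exp (l * S\<^sub>m - c * l powr \<beta> * G\<^sub>m)\<close> has expectation at most 1
  (\<open>exp_supermartingale_nn_integral_le_1\<close>). On the event \<open>S\<^sub>n \<ge> x * V\<close> the exponent is large for
  the \<open>l\<close> that is matched to the value of \<open>V\<close>. As \<open>V\<close> is random, its range, whose endpoints have
  logarithms \<open>L / e\<close> apart, is cut into at most \<open>1 + L / (e * s)\<close> cells of logarithmic length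
  \<open>s\<close>, and Markov's inequality is applied on each cell with its own \<open>l\<close>
  (\<open>self_normalized_tail_peeling\<close>).

  The constant \<open>c\<close> decides whether this suffices. With \<open>c = 1\<close> the best exponent would be \<open>e * T\<close>,
  and for \<open>\<beta>\<close> near 1 it is too small to pay for a number of cells that grows like \<open>1 / e\<close>. A smaller
  \<open>c\<close> multiplies the exponent by \<open>c powr (- 1 / e)\<close>. The choice
  \<open>c = (e / exp (1 - e)) powr e\<close> (\<open>quadratic_over_linear_le_powr\<close>) makes this factor
  \<open>exp (1 - e) / e\<close>, so that the exponent stays of the order of \<open>T\<close>, and yields the bound
  \<open>(1 + L / (e * s)) * exp (- (exp (1 - e - s) * T))\<close> for every \<open>s > 0\<close>.

  It remains to choose \<open>s\<close>. For \<open>e \<ge> 1 / 4\<close> the cell length \<open>s = 1 / (2 * e)\<close> turns the number of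
  cells into \<open>1 + 2 * L\<close>, and the exponent is still large enough
  (\<open>peeling_bound_large_exponent\<close>). For \<open>e \<le> 1 / 4\<close> the choice \<open>s = 1 - e\<close> gives the exponent
  \<open>T\<close>, and the excess \<open>T / (1 + e)\<close> over the target absorbs the number of cells, unless \<open>L\<close> is
  so large that the asserted bound is at least 1 (\<open>peeling_bound_small_exponent\<close>). In both cases
  \<open>1 + 2 * L\<close> appears as the prefactor, which is at most the one asserted.
\<close>

section \<open>Two elementary inequalities\<close>

text \<open>
  Optimising over \<open>y\<close> gives the best constant \<open>e powr e * (1 - e) powr (1 - e)\<close>; it comes out
  of the weighted inequality between the arithmetic and the geometric mean of \<open>1 / e\<close> and
  \<open>y / (1 - e)\<close>. Replacing \<open>(1 - e) powr (1 - e)\<close> by the larger \<open>exp (- e * (1 - e))\<close> makes the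
  constant a pure \<open>e\<close>-th power, so that its \<open>1 / e\<close>-th root, which enters the exponent, is simple.
\<close>

lemma quadratic_over_linear_le_powr:
  fixes e y :: real
  assumes "0 < e" "e < 1" "0 \<le> y"
  shows "y\<^sup>2 / (1 + y) \<le> (e / exp (1 - e)) powr e * y powr (1 + e)"
proof (cases "y = 0")
  case True
  then show ?thesis by simp
next
  case False
  with assms have y: "y > 0" by simp
  have "(1 / e) powr e * (y / (1 - e)) powr (1 - e) \<le> e * (1 / e) + (1 - e) * (y / (1 - e))"
    using assms y by (intro Youngs_inequality_0) auto
  also have "\<dots> = 1 + y" using assms by simp
  finally have "ln ((1 / e) powr e * (y / (1 - e)) powr (1 - e)) \<le> ln (1 + y)"
    using assms y by (subst ln_le_cancel_iff) auto
  moreover have "ln ((1 / e) powr e * (y / (1 - e)) powr (1 - e))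
      = (1 - e) * (ln y - ln (1 - e)) - e * ln e"
    using assms y by (simp add: ln_mult ln_div)
  moreover have "(1 - e) * ln (1 - e) \<le> (1 - e) * (- e)"
    using assms ln_le_minus_one[of "1 - e"] by (intro mult_left_mono) auto
  ultimately have "2 * ln y - ln (1 + y) \<le> e * (ln e - (1 - e)) + (1 + e) * ln y"
    by (simp add: algebra_simps)
  then have "exp (2 * ln y - ln (1 + y)) \<le> exp (e * (ln e - (1 - e)) + (1 + e) * ln y)"
    by simp
  moreover have "exp (2 * ln y - ln (1 + y)) = y\<^sup>2 / (1 + y)"
    using y by (simp add: exp_diff exp_double)
  moreover have "exp (e * (ln e - (1 - e)) + (1 + e) * ln y)
      = (e / exp (1 - e)) powr e * y powr (1 + e)"
    using assms y by (simp add: exp_add powr_def ln_div)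
  ultimately show ?thesis by simp
qed

text \<open>
  Both signs of \<open>y\<close> reduce to the same quadratic-over-linear term: \<open>ln (1 + y) \<ge> y / (1 + y)\<close>,
  which is \<open>y - y\<^sup>2 / (1 + y)\<close>, and \<open>exp (- z) \<le> 1 / (1 + z)\<close>, which is
  \<open>1 - z + z\<^sup>2 / (1 + z)\<close>.
\<close>

lemma exp_tilted_le_linear:
  fixes \<beta> c y :: real
  assumes c: "\<And>z. 0 \<le> z \<Longrightarrow> z\<^sup>2 / (1 + z) \<le> c * z powr \<beta>"
  shows "exp (y - c * max y 0 powr \<beta>) \<le> 1 + y + c * max (- y) 0 powr \<beta>"
proof (cases "y \<ge> 0")
  case True
  have "y - c * y powr \<beta> \<le> y - y\<^sup>2 / (1 + y)" using c[OF True] by simp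
  also have "\<dots> = 1 - 1 / (1 + y)" using True by (simp add: field_simps power2_eq_square)
  also have "\<dots> \<le> ln (1 + y)"
    using True ln_le_minus_one[of "1 / (1 + y)"] by (simp add: ln_div)
  finally have "exp (y - c * y powr \<beta>) \<le> exp (ln (1 + y))" by simp
  with True assms show ?thesis by (simp add: max_def)
next
  case False
  define z where "z = - y"
  have z: "z > 0" using False by (simp add: z_def)
  have "exp (- z) \<le> 1 / (1 + z)"
    using z exp_ge_add_one_self[of z] by (simp add: exp_minus field_simps)
  also have "\<dots> = 1 - z + z\<^sup>2 / (1 + z)" using z by (simp add: field_simps power2_eq_square)
  also have "\<dots> \<le> 1 - z + c * z powr \<beta>" using c[of z] z by simp
  finally show ?thesis using z assms by (simp add: z_def max_def)
qed

section \<open>The exponential supermartingale\<close>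

text \<open>
  Stated with nonnegative integrals, so that the weight \<open>W\<close> needs no integrability: in the
  application it is the exponential of unbounded quantities.
\<close>

lemma (in sigma_finite_subalgebra) nn_integral_mult_le_of_real_cond_exp_le:
  fixes W Z R :: "'a \<Rightarrow> real"
  assumes W: "W \<in> borel_measurable F"
    and Z: "integrable M Z" "\<And>\<omega>. 0 \<le> Z \<omega>"
    and R: "AE \<omega> in M. real_cond_exp M F Z \<omega> \<le> R \<omega>"
  shows "(\<integral>\<^sup>+\<omega>. ennreal (W \<omega>) * ennreal (Z \<omega>) \<partial>M) \<le> (\<integral>\<^sup>+\<omega>. ennreal (W \<omega>) * ennreal (R \<omega>) \<partial>M)"
proof -
  have [measurable]: "W \<in> borel_measurable F" "Z \<in> borel_measurable M" using W Z by auto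
  let ?N = "nn_cond_exp M F (\<lambda>\<omega>. ennreal (Z \<omega>))"
  have "(\<integral>\<^sup>+\<omega>. ?N \<omega> \<partial>M) = (\<integral>\<^sup>+\<omega>. ennreal (Z \<omega>) \<partial>M)"
    using nn_cond_exp_intg[of "\<lambda>_. 1" "\<lambda>\<omega>. ennreal (Z \<omega>)"] by simp
  also have "\<dots> < \<infinity>" using Z by (simp add: nn_integral_eq_integral)
  finally have "AE \<omega> in M. ?N \<omega> \<noteq> \<infinity>"
    by (intro nn_integral_noteq_infinite) (auto intro: measurable_from_subalg[OF subalg])
  \<comment> \<open>The negative part of \<open>Z\<close> vanishes, so only the positive part contributes to its real
    conditional expectation.\<close>
  moreover have "AE \<omega> in M. 0 = nn_cond_exp M F (\<lambda>_. 0) \<omega>"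
    by (rule nn_cond_exp_F_meas[of "\<lambda>_. 0"]) auto
  ultimately have "AE \<omega> in M. ?N \<omega> \<le> ennreal (R \<omega>)"
    using R
  proof eventually_elim
    case (elim \<omega>)
    have "enn2real (?N \<omega>) \<le> R \<omega>"
      using elim Z(2) by (simp add: real_cond_exp_def ennreal_neg)
    then have "ennreal (enn2real (?N \<omega>)) \<le> ennreal (R \<omega>)" by (rule ennreal_leI)
    with elim show ?case by (simp add: less_top)
  qed
  then have "(\<integral>\<^sup>+\<omega>. ennreal (W \<omega>) * ?N \<omega> \<partial>M) \<le> (\<integral>\<^sup>+\<omega>. ennreal (W \<omega>) * ennreal (R \<omega>) \<partial>M)"
    by (intro nn_integral_mono_AE) (auto elim!: eventually_mono intro: mult_left_mono)
  then show ?thesis by (subst nn_cond_exp_intg[symmetric]) auto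
qed

lemma G_stat_Suc:
  "G_stat P (Suc m) F \<xi> \<beta> \<omega> = G_stat P m F \<xi> \<beta> \<omega> + max (\<xi> (Suc m) \<omega>) 0 powr \<beta>
     + real_cond_exp P (F m) (\<lambda>\<omega>'. max (- \<xi> (Suc m) \<omega>') 0 powr \<beta>) \<omega>"
  by (simp add: G_stat_def)

lemma martingale_differences_adapted:
  assumes "martingale_differences P n F \<xi>" "m \<le> n"
  shows "partial_sum m \<xi> \<in> borel_measurable (F m)" "G_stat P m F \<xi> \<beta> \<in> borel_measurable (F m)"
proof -
  have sub: "subalgebra (F m) (F i)" if "i \<le> m" for i
    using assms that unfolding martingale_differences_def subalgebra_def
    by (metis order_trans)
  have [measurable]: "\<xi> i \<in> borel_measurable (F m)" if "i \<in> {1..m}" for i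
    using assms that by (intro measurable_from_subalg[OF sub]) (auto simp: martingale_differences_def)
  have [measurable]: "real_cond_exp P (F (i - 1)) f \<in> borel_measurable (F m)" if "i \<in> {1..m}" for i f
    using that by (intro measurable_from_subalg[OF sub borel_measurable_cond_exp]) auto
  show "partial_sum m \<xi> \<in> borel_measurable (F m)"
    unfolding partial_sum_def[abs_def] by measurable
  show "G_stat P m F \<xi> \<beta> \<in> borel_measurable (F m)"
    unfolding G_stat_def[abs_def] by measurable
qed

text \<open>
  The positive part of \<open>\<xi>\<^sub>i\<close> is compensated pathwise and the negative part through its
  conditional expectation, which is why \<open>G\<^sub>n\<close> mixes the two kinds of terms: the hypothesis on \<open>l\<close>
  and \<open>d\<close> removes the positive part before conditioning, and \<open>1 + u \<le> exp u\<close> then removes the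
  conditional moment of the negative part.
\<close>

lemma exp_supermartingale_nn_integral_le_1:
  fixes \<xi> :: "nat \<Rightarrow> 'a \<Rightarrow> real"
  assumes "prob_space P" and md: "martingale_differences P n F \<xi>"
    and int: "\<And>i. i \<le> n \<Longrightarrow> integrable P (\<lambda>\<omega>. \<bar>\<xi> i \<omega>\<bar> powr \<beta>)"
    and ineq: "\<And>y. exp (l * y - d * max y 0 powr \<beta>) \<le> 1 + l * y + d * max (- y) 0 powr \<beta>"
    and "m \<le> n"
  shows "(\<integral>\<^sup>+\<omega>. ennreal (exp (l * partial_sum m \<xi> \<omega> - d * G_stat P m F \<xi> \<beta> \<omega>)) \<partial>P) \<le> 1"
  using \<open>m \<le> n\<close>
proof (induction m)
  case 0
  interpret prob_space P by fact
  show ?case by (simp add: partial_sum_def G_stat_def emeasure_space_1)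
next
  case (Suc m)
  interpret prob_space P by fact
  interpret finite_measure_subalgebra P "F m"
    using md Suc.prems by unfold_locales (auto simp: martingale_differences_def)
  let ?U = "\<lambda>k \<omega>. exp (l * partial_sum k \<xi> \<omega> - d * G_stat P k F \<xi> \<beta> \<omega>)"
  let ?X = "\<xi> (Suc m)"
  let ?N = "\<lambda>\<omega>. max (- ?X \<omega>) 0 powr \<beta>"
  let ?Q = "real_cond_exp P (F m) ?N"
  let ?Z = "\<lambda>\<omega>. 1 + (l * ?X \<omega> + d * ?N \<omega>)"
  let ?W = "\<lambda>\<omega>. ?U m \<omega> * exp (- d * ?Q \<omega>)"
  have X: "integrable P ?X" using md Suc.prems by (auto simp: martingale_differences_def)
  have [measurable]: "?X \<in> borel_measurable P" using X by auto
  have N: "integrable P ?N"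
    by (rule Bochner_Integration.integrable_bound[OF int[OF Suc.prems]])
       (auto simp: max_def)
  have "\<forall>i\<in>{1..n}. AE \<omega> in P. real_cond_exp P (F (i - 1)) (\<xi> i) \<omega> = 0"
    using md by (simp add: martingale_differences_def)
  then have "AE \<omega> in P. real_cond_exp P (F (Suc m - 1)) ?X \<omega> = 0"
    using Suc.prems by (intro bspec[where x = "Suc m"]) auto
  then have "AE \<omega> in P. real_cond_exp P (F m) ?X \<omega> = 0" by simp
  moreover have "AE \<omega> in P. real_cond_exp P (F m) ?Z \<omega>
      = real_cond_exp P (F m) (\<lambda>_. 1) \<omega> + real_cond_exp P (F m) (\<lambda>\<omega>. l * ?X \<omega> + d * ?N \<omega>) \<omega>"
    using X N by (intro real_cond_exp_add) auto
  moreover have "AE \<omega> in P. real_cond_exp P (F m) (\<lambda>_. 1) \<omega> = 1"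
    by (rule real_cond_exp_F_meas) auto
  moreover have "AE \<omega> in P. real_cond_exp P (F m) (\<lambda>\<omega>. l * ?X \<omega> + d * ?N \<omega>) \<omega>
      = real_cond_exp P (F m) (\<lambda>\<omega>. l * ?X \<omega>) \<omega> + real_cond_exp P (F m) (\<lambda>\<omega>. d * ?N \<omega>) \<omega>"
    using X N by (intro real_cond_exp_add) auto
  moreover have "AE \<omega> in P. real_cond_exp P (F m) (\<lambda>\<omega>. l * ?X \<omega>) \<omega> = l * real_cond_exp P (F m) ?X \<omega>"
    using X by (rule real_cond_exp_cmult)
  moreover have "AE \<omega> in P. real_cond_exp P (F m) (\<lambda>\<omega>. d * ?N \<omega>) \<omega> = d * ?Q \<omega>"
    using N by (rule real_cond_exp_cmult)
  ultimately have R: "AE \<omega> in P. real_cond_exp P (F m) ?Z \<omega> \<le> exp (d * ?Q \<omega>)"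
  proof eventually_elim
    case (elim \<omega>)
    then show ?case using exp_ge_add_one_self[of "d * ?Q \<omega>"] by simp
  qed
  \<comment> \<open>As the upper bound of an exponential, the linearised factor is nonnegative.\<close>
  have Zpos: "0 \<le> ?Z \<omega>" for \<omega>
    using ineq[of "?X \<omega>"] exp_ge_zero[of "l * ?X \<omega> - d * max (?X \<omega>) 0 powr \<beta>"] by linarith
  have "m \<le> n" using Suc.prems by simp
  note [measurable] = martingale_differences_adapted[OF md \<open>m \<le> n\<close>]
  have W: "?W \<in> borel_measurable (F m)" by measurable
  have Z: "integrable P ?Z" using X N by auto
  have step: "?U (Suc m) \<omega> \<le> ?W \<omega> * ?Z \<omega>" for \<omega>
  proof -
    have "?U (Suc m) \<omega> = ?W \<omega> * exp (l * ?X \<omega> - d * max (?X \<omega>) 0 powr \<beta>)"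
      by (simp add: G_stat_Suc partial_sum_def algebra_simps flip: exp_add)
    also have "\<dots> \<le> ?W \<omega> * ?Z \<omega>" using ineq[of "?X \<omega>"] by (intro mult_left_mono) auto
    finally show ?thesis .
  qed
  have "(\<integral>\<^sup>+\<omega>. ennreal (?U (Suc m) \<omega>) \<partial>P) \<le> (\<integral>\<^sup>+\<omega>. ennreal (?W \<omega>) * ennreal (?Z \<omega>) \<partial>P)"
    using step Zpos by (intro nn_integral_mono) (simp flip: ennreal_mult)
  also have "\<dots> \<le> (\<integral>\<^sup>+\<omega>. ennreal (?W \<omega>) * ennreal (exp (d * ?Q \<omega>)) \<partial>P)"
    by (rule nn_integral_mult_le_of_real_cond_exp_le[OF W Z Zpos R])
  also have "\<dots> = (\<integral>\<^sup>+\<omega>. ennreal (?U m \<omega>) \<partial>P)"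
    by (intro nn_integral_cong) (simp add: exp_minus flip: ennreal_mult)
  also have "\<dots> \<le> 1" using Suc by simp
  finally show ?case .
qed

lemma exp_supermartingale_tail:
  fixes \<xi> :: "nat \<Rightarrow> 'a \<Rightarrow> real"
  assumes "prob_space P" and md: "martingale_differences P n F \<xi>"
    and int: "\<And>i. i \<le> n \<Longrightarrow> integrable P (\<lambda>\<omega>. \<bar>\<xi> i \<omega>\<bar> powr \<beta>)"
    and ineq: "\<And>y. exp (l * y - d * max y 0 powr \<beta>) \<le> 1 + l * y + d * max (- y) 0 powr \<beta>"
  shows "{\<omega> \<in> space P. q \<le> l * partial_sum n \<xi> \<omega> - d * G_stat P n F \<xi> \<beta> \<omega>} \<in> sets P" (is "?A \<in> _")
    and "measure P {\<omega> \<in> space P. q \<le> l * partial_sum n \<xi> \<omega> - d * G_stat P n F \<xi> \<beta> \<omega>} \<le> exp (- q)"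
proof -
  interpret prob_space P by fact
  have sub: "subalgebra P (F n)" using md by (simp add: martingale_differences_def)
  note [measurable] = martingale_differences_adapted[OF md order_refl, THEN measurable_from_subalg[OF sub]]
  let ?E = "\<lambda>\<omega>. l * partial_sum n \<xi> \<omega> - d * G_stat P n F \<xi> \<beta> \<omega>"
  show "?A \<in> sets P" by measurable
  have "?A = {\<omega> \<in> space P. 1 \<le> ennreal (exp (- q)) * ennreal (exp (?E \<omega>))}"
    by (auto simp flip: ennreal_mult exp_add)
  then have "emeasure P ?A = emeasure P {\<omega> \<in> space P. 1 \<le> ennreal (exp (- q)) * ennreal (exp (?E \<omega>))}"
    by simp
  also have "\<dots> \<le> ennreal (exp (- q)) * (\<integral>\<^sup>+\<omega>. ennreal (exp (?E \<omega>)) * indicator (space P) \<omega> \<partial>P)"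
    by (rule nn_integral_Markov_inequality) auto
  also have "(\<integral>\<^sup>+\<omega>. ennreal (exp (?E \<omega>)) * indicator (space P) \<omega> \<partial>P) = (\<integral>\<^sup>+\<omega>. ennreal (exp (?E \<omega>)) \<partial>P)"
    by (intro nn_integral_cong) simp
  also have "ennreal (exp (- q)) * \<dots> \<le> ennreal (exp (- q)) * 1"
    by (intro mult_left_mono exp_supermartingale_nn_integral_le_1[OF assms order_refl]) auto
  finally show "measure P ?A \<le> exp (- q)"
    by (simp add: emeasure_eq_measure)
qed

section \<open>Peeling over the scale of the normalisation\<close>

text \<open>
  The value of \<open>l\<close> is chosen so that \<open>((\<beta> - 1) / K) powr (\<beta> - 1) * (l * V) powr (\<beta> - 1)\<close> equals
  \<open>x / \<beta>\<close> at the upper end \<open>V = V0\<close> of the cell. Inside the cell this quantity is smaller, so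
  the penalty is at most the fraction \<open>1 / \<beta>\<close> of the gain \<open>l * V * x\<close>, and the gain loses at most
  the factor \<open>a\<close>.
\<close>

lemma peeling_exponent_ge:
  fixes \<beta> K x V V0 a S l :: real
  assumes "1 < \<beta>" "0 < K" "0 < x" "0 < V0" "0 < a"
    and V: "V0 / a \<le> V" "V \<le> V0" and S: "x * V \<le> S"
    and l: "l = K / (\<beta> - 1) * (x / \<beta>) powr (1 / (\<beta> - 1)) / V0"
  shows "K / a * (x / \<beta>) powr (\<beta> / (\<beta> - 1))
      \<le> l * S - ((\<beta> - 1) / K) powr (\<beta> - 1) * l powr \<beta> * V powr \<beta>"
proof -
  define e where "e = \<beta> - 1"
  define c where "c = (e / K) powr e"
  define r where "r = K / e * (x / \<beta>) powr (1 / e)"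
  have e: "e > 0" "\<beta> = 1 + e" using \<open>1 < \<beta>\<close> by (simp_all add: e_def)
  have r: "r > 0" using assms e by (auto simp: r_def)
  have lr: "l = r / V0" using l by (simp add: r_def e_def)
  have l0: "l > 0" using r assms by (simp add: lr)
  have V0: "V > 0" using assms by (auto intro: less_le_trans[OF divide_pos_pos[of V0 a]])
  have lV: "l * V > 0" "l * V \<le> r" "r / a \<le> l * V"
    using assms l0 V0 r by (auto simp: lr field_simps)
  have cr: "c * r powr e = x / \<beta>"
  proof -
    have "r powr e = (K / e) powr e * ((x / \<beta>) powr (1 / e)) powr e"
      unfolding r_def using assms e by (intro powr_mult)
    also have "((x / \<beta>) powr (1 / e)) powr e = x / \<beta>"
      using assms e by (simp add: powr_powr)
    finally have "r powr e = (K / e) powr e * (x / \<beta>)" .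
    moreover have "c * (K / e) powr e = ((e / K) * (K / e)) powr e"
      unfolding c_def using assms e by (intro powr_mult[symmetric])
    ultimately show ?thesis using assms e by simp
  qed
  have "c * (l * V) powr e \<le> c * r powr e"
    using lV e by (intro mult_left_mono powr_mono2) (auto simp: c_def)
  then have cV: "c * (l * V) powr e \<le> x / \<beta>" using cr by simp
  have "K / a * (x / \<beta>) powr (\<beta> / e) = r / a * (x * e / \<beta>)"
  proof -
    have "\<beta> / e = 1 / e + 1" using e by (simp add: field_simps)
    then have "(x / \<beta>) powr (\<beta> / e) = (x / \<beta>) powr (1 / e) * (x / \<beta>)"
      using assms e by (simp add: powr_add)
    then show ?thesis using e by (simp add: r_def)
  qed
  also have "\<dots> \<le> l * V * (x * e / \<beta>)"
    using lV(3) assms e by (intro mult_right_mono) auto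
  also have "\<dots> = l * V * (x - x / \<beta>)" using e by (simp add: field_simps)
  also have "\<dots> \<le> l * V * (x - c * (l * V) powr e)"
    using cV lV by (intro mult_left_mono) auto
  also have "\<dots> = l * (x * V) - c * (l * V) powr \<beta>"
    using lV by (simp add: e powr_add algebra_simps)
  also have "\<dots> \<le> l * S - c * (l * V) powr \<beta>" using S l0 by simp
  also have "(l * V) powr \<beta> = l powr \<beta> * V powr \<beta>" using l0 V0 by (simp add: powr_mult)
  finally show ?thesis by (simp add: c_def e_def mult.assoc)
qed

lemma ex_geometric_scale:
  fixes s v V h :: real
  assumes "0 < s" "0 < v" "v \<le> V" "V \<le> v * exp h"
  obtains k where "k \<le> nat \<lfloor>h / s\<rfloor>" "v * exp (real k * s) \<le> V" "V \<le> v * exp (real (Suc k) * s)"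
proof
  define r where "r = ln (V / v)"
  define k where "k = nat \<lfloor>r / s\<rfloor>"
  have V: "V = v * exp r" using assms by (simp add: r_def)
  have r: "0 \<le> r" "r \<le> h"
    using assms unfolding V by simp_all
  have k: "real k = of_int \<lfloor>r / s\<rfloor>" using r assms by (simp add: k_def)
  have "real k \<le> r / s" "r / s \<le> real (Suc k)" using k by linarith+
  then have "real k * s \<le> r" "r \<le> real (Suc k) * s"
    using assms by (simp_all only: pos_le_divide_eq pos_divide_le_eq)
  then show "v * exp (real k * s) \<le> V" "V \<le> v * exp (real (Suc k) * s)"
    using assms unfolding V by simp_all
  show "k \<le> nat \<lfloor>h / s\<rfloor>"
    unfolding k_def using r assms by (intro nat_mono floor_mono divide_right_mono) auto
qed

lemma G_stat_nonneg_AE: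
  assumes "prob_space P" and md: "martingale_differences P n F \<xi>"
  shows "AE \<omega> in P. 0 \<le> G_stat P n F \<xi> \<beta> \<omega>"
proof -
  interpret prob_space P by fact
  have "AE \<omega> in P. 0 \<le> real_cond_exp P (F (i - 1)) (\<lambda>\<omega>'. max (- \<xi> i \<omega>') 0 powr \<beta>) \<omega>"
    if "i \<in> {1..n}" for i
  proof -
    interpret finite_measure_subalgebra P "F (i - 1)"
      using md that by unfold_locales (auto simp: martingale_differences_def)
    have [measurable]: "\<xi> i \<in> borel_measurable P"
      using md that by (auto simp: martingale_differences_def)
    show ?thesis by (intro real_cond_exp_pos) auto
  qed
  then have "AE \<omega> in P. \<forall>i\<in>{1..n}. 0 \<le> real_cond_exp P (F (i - 1)) (\<lambda>\<omega>'. max (- \<xi> i \<omega>') 0 powr \<beta>) \<omega>"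
    by (intro AE_finite_allI) auto
  then show ?thesis
    by eventually_elim (auto simp: G_stat_def intro!: add_nonneg_nonneg sum_nonneg)
qed

text \<open>
  One cell costs \<open>exp (- q)\<close> with the exponent \<open>q\<close> of the lemma \<open>peeling_exponent_ge\<close> for
  \<open>K = exp (2 - \<beta>)\<close> and \<open>a = exp s\<close>; the factor in front bounds the number of cells. The lower
  bound on the normalisation excludes the points where \<open>G\<^sub>n\<close> vanishes.
\<close>

lemma self_normalized_tail_peeling:
  fixes \<xi> :: "nat \<Rightarrow> 'a \<Rightarrow> real" and \<beta> b M x s :: real
  assumes "prob_space P" and md: "martingale_differences P n F \<xi>"
    and int: "\<And>i. i \<le> n \<Longrightarrow> integrable P (\<lambda>\<omega>. \<bar>\<xi> i \<omega>\<bar> powr \<beta>)"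
    and \<beta>: "1 < \<beta>" "\<beta> < 2" and bM: "0 < b" "1 \<le> M" and "0 < x" "0 < s"
  shows "measure P {\<omega> \<in> space P.
             partial_sum n \<xi> \<omega> / (G_stat P n F \<xi> \<beta> \<omega>) powr (1 / \<beta>) \<ge> x \<and>
             b powr (1 / (\<beta> - 1)) \<le> (G_stat P n F \<xi> \<beta> \<omega>) powr (1 / \<beta>) \<and>
             (G_stat P n F \<xi> \<beta> \<omega>) powr (1 / \<beta>) \<le> (b * M) powr (1 / (\<beta> - 1))}
         \<le> (1 + ln M / ((\<beta> - 1) * s)) * exp (- (exp (2 - \<beta> - s) * (x / \<beta>) powr (\<beta> / (\<beta> - 1))))"
    (is "measure P ?A \<le> _ * exp (- ?q)")
proof -
  interpret prob_space P by fact
  define c where "c = ((\<beta> - 1) / exp (2 - \<beta>)) powr (\<beta> - 1)"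
  define v where "v = b powr (1 / (\<beta> - 1))"
  define h where "h = ln M / (\<beta> - 1)"
  define m where "m = nat \<lfloor>h / s\<rfloor>"
  define V0 where "V0 k = v * exp (real (Suc k) * s)" for k :: nat
  define l where "l k = exp (2 - \<beta>) / (\<beta> - 1) * (x / \<beta>) powr (1 / (\<beta> - 1)) / V0 k" for k
  define B where "B k = {\<omega> \<in> space P. ?q \<le> l k * partial_sum n \<xi> \<omega>
                           - c * l k powr \<beta> * G_stat P n F \<xi> \<beta> \<omega>}" for k
  have v: "v > 0" using bM by (simp add: v_def)
  have h: "h \<ge> 0" using \<beta> bM by (simp add: h_def)
  have vh: "(b * M) powr (1 / (\<beta> - 1)) = v * exp h"
    using bM by (simp add: v_def h_def powr_mult) (simp add: powr_def)
  have l: "l k > 0" for k using v \<beta> \<open>0 < x\<close> by (simp add: l_def V0_def)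
  have c: "z\<^sup>2 / (1 + z) \<le> c * z powr \<beta>" if "0 \<le> z" for z
    using quadratic_over_linear_le_powr[of "\<beta> - 1" z] \<beta> that by (simp add: c_def)
  have ineq: "exp (l k * y - c * l k powr \<beta> * max y 0 powr \<beta>)
      \<le> 1 + l k * y + c * l k powr \<beta> * max (- y) 0 powr \<beta>" for k y
  proof -
    have "max (l k * y) 0 = l k * max y 0" "max (- (l k * y)) 0 = l k * max (- y) 0"
      using l[of k] by (auto simp: max_def zero_le_mult_iff mult_le_0_iff)
    then show ?thesis
      using exp_tilted_le_linear[OF c, of "l k * y"] l[of k] by (simp add: powr_mult mult.assoc)
  qed
  have B: "B k \<in> sets P" "measure P (B k) \<le> exp (- ?q)" for k
    unfolding B_def by (rule exp_supermartingale_tail[OF assms(1) md int ineq]; assumption)+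
  have "AE \<omega> in P. \<omega> \<in> ?A \<longrightarrow> \<omega> \<in> (\<Union>k\<le>m. B k)"
    using G_stat_nonneg_AE[OF assms(1) md, of \<beta>]
  proof eventually_elim
    case (elim \<omega>)
    show ?case
    proof
      assume A: "\<omega> \<in> ?A"
      let ?G = "G_stat P n F \<xi> \<beta> \<omega>"
      define V where "V = ?G powr (1 / \<beta>)"
      have V: "v \<le> V" "V \<le> v * exp h" "x \<le> partial_sum n \<xi> \<omega> / V"
        using A vh by (auto simp: V_def v_def)
      have "V > 0" using V v by simp
      have G: "?G = V powr \<beta>" using elim \<beta> by (simp add: V_def powr_powr)
      have S: "x * V \<le> partial_sum n \<xi> \<omega>" using V(3) \<open>V > 0\<close> by (simp add: field_simps)
      obtain k where k: "k \<le> m" "v * exp (real k * s) \<le> V" "V \<le> V0 k"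
        using ex_geometric_scale[OF \<open>0 < s\<close> v V(1,2)] unfolding m_def V0_def by blast
      have "V0 k / exp s \<le> V"
        using k(2) by (simp add: V0_def distrib_right exp_add)
      then have "exp (2 - \<beta>) / exp s * (x / \<beta>) powr (\<beta> / (\<beta> - 1))
          \<le> l k * partial_sum n \<xi> \<omega> - c * l k powr \<beta> * V powr \<beta>"
        unfolding c_def using \<beta> \<open>0 < x\<close> v k S
        by (intro peeling_exponent_ge[where ?V0.0 = "V0 k"]) (auto simp: V0_def l_def)
      then have "\<omega> \<in> B k" using A by (simp add: B_def G exp_diff)
      then show "\<omega> \<in> (\<Union>k\<le>m. B k)" using k by blast
    qed
  qed
  then have "measure P ?A \<le> measure P (\<Union>k\<le>m. B k)"
    using B by (intro finite_measure_mono_AE) auto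
  also have "\<dots> \<le> (\<Sum>k\<le>m. measure P (B k))"
    using B by (intro finite_measure_subadditive_finite) auto
  also have "\<dots> \<le> (\<Sum>k\<le>m. exp (- ?q))" by (intro sum_mono B)
  also have "\<dots> = (1 + real m) * exp (- ?q)" by simp
  also have "\<dots> \<le> (1 + ln M / ((\<beta> - 1) * s)) * exp (- ?q)"
  proof -
    have "real m \<le> h / s" using h \<open>0 < s\<close> by (simp add: m_def)
    then show ?thesis by (intro mult_right_mono) (auto simp: h_def)
  qed
  finally show ?thesis .
qed

section \<open>Choice of the cell length\<close>

text \<open>
  Split \<open>T = w + y\<close>, where \<open>w = T * e / (1 + e)\<close> is the exponent aimed at and \<open>y = w / e\<close> is the
  surplus. If \<open>exp w \<le> 1 + 2 * L\<close>, the asserted bound is at least 1. Otherwise \<open>L\<close> is controlled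
  by \<open>w\<close>, and the surplus has to satisfy \<open>1 + L / (e * (1 - e)) \<le> (1 + 2 * L) * exp y\<close>. For small
  \<open>w\<close> this holds because \<open>L\<close> is of the order of \<open>w = e * y\<close>; for \<open>w\<close> bounded away from 0
  because \<open>exp y\<close> is then exponentially large in \<open>1 / e\<close>.
\<close>

lemma peeling_bound_small_exponent:
  fixes e T L p :: real
  assumes e: "0 < e" "e \<le> 1 / 4" and T: "0 \<le> T" and L: "0 \<le> L"
    and p: "p \<le> 1" "p \<le> (1 + L / (e * (1 - e))) * exp (- T)"
  shows "p \<le> (1 + 2 * L) * exp (- (T * (e / (1 + e))))"
proof -
  define y where "y = T / (1 + e)"
  define w where "w = e * y"
  have y: "y \<ge> 0" using e T by (simp add: y_def)
  have w: "w \<ge> 0" using e y by (simp add: w_def)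
  have Tw: "T * (e / (1 + e)) = w" by (simp add: w_def y_def)
  have "y * (1 + e) = T" using e by (simp add: y_def)
  then have Twy: "T = w + y" by (simp add: w_def algebra_simps)
  show ?thesis
  proof (cases "exp w \<le> 1 + 2 * L")
    case True
    then have "exp w * exp (- w) \<le> (1 + 2 * L) * exp (- w)" by (intro mult_right_mono) auto
    then show ?thesis using p(1) unfolding Tw by (simp flip: exp_add)
  next
    case False
    then have L2: "2 * L < exp w - 1" by simp
    have "1 + L / (e * (1 - e)) \<le> (1 + 2 * L) * exp y"
      \<comment> \<open>The threshold is the least value of \<open>2 * (1 - e)\<close>, below which the linear bound on \<open>L\<close> is
        good enough.\<close>
    proof (cases "exp w \<le> 3 / 2")
      case True
      have "1 - w \<le> exp (- w)" using exp_ge_add_one_self[of "- w"] by simp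
      then have "(1 - w) * exp w \<le> exp (- w) * exp w" by (intro mult_right_mono) auto
      then have "exp w - 1 \<le> w * exp w" by (simp add: algebra_simps flip: exp_add)
      also have "\<dots> \<le> w * (2 * (1 - e))" using True e w by (intro mult_left_mono) auto
      also have "\<dots> = 2 * (w * (1 - e))" by simp
      finally have "L \<le> w * (1 - e)" using L2 by simp
      then have "L / (e * (1 - e)) \<le> y"
        using e by (simp add: w_def field_simps)
      then have "1 + L / (e * (1 - e)) \<le> exp y" using exp_ge_add_one_self[of y] by linarith
      also have "\<dots> \<le> (1 + 2 * L) * exp y" using L by simp
      finally show ?thesis .
    next
      case False
      define q where "q = 1 / e"
      have q: "q \<ge> 4" using e by (simp add: q_def field_simps)
      have "1 / 3 \<le> ln (3 / 2 :: real)" using ln_le_minus_one[of "2 / 3 :: real"] by (simp add: ln_div)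
      also have "\<dots> \<le> ln (exp w)" using False by (subst ln_le_cancel_iff) auto
      finally have "1 / 3 \<le> w" by simp
      then have yq: "q / 3 \<le> y" using e by (simp add: w_def q_def field_simps)
      \<comment> \<open>The quadratic \<open>q\<^sup>2 - 6 * q + 18\<close> has no real root, which is what the second-order
        lower bound of \<open>exp (q / 3)\<close> needs to dominate \<open>2 * q / 3\<close>.\<close>
      have "0 \<le> (q - 3)\<^sup>2 + 9" by simp
      then have "2 * q / 3 \<le> 1 + q / 3 + (q / 3)\<^sup>2 / 2" by (simp add: power2_eq_square field_simps)
      also have "\<dots> \<le> exp (q / 3)" using q by (intro exp_lower_Taylor_quadratic) simp
      also have "\<dots> \<le> exp y" using yq by simp
      finally have "4 * q / 3 \<le> 2 * exp y" by simp
      moreover have "1 / (e * (1 - e)) \<le> 4 * q / 3"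
        using e by (simp add: q_def field_simps)
      ultimately have "1 / (e * (1 - e)) \<le> 2 * exp y" by linarith
      then have "L * (1 / (e * (1 - e))) \<le> L * (2 * exp y)" using L by (intro mult_left_mono)
      moreover have "1 \<le> exp y" using y by simp
      moreover have "L * (1 / (e * (1 - e))) = L / (e * (1 - e))" by simp
      moreover have "(1 + 2 * L) * exp y = exp y + L * (2 * exp y)" by (simp add: algebra_simps)
      ultimately show ?thesis by linarith
    qed
    then have "(1 + L / (e * (1 - e))) * exp (- T) \<le> (1 + 2 * L) * exp y * exp (- T)"
      by (intro mult_right_mono) auto
    also have "\<dots> = (1 + 2 * L) * exp (- w)" by (simp add: Twy flip: exp_add)
    finally show ?thesis using p(2) unfolding Tw by linarith
  qed
qed

text \<open>
  With \<open>z = 1 / e\<close> the required comparison of exponents is \<open>exp (z / 2 + 1 / z - 1) \<le> 1 + z\<close>.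
  It holds on \<open>{1..4}\<close> with enough room that on each of three subintervals the left side can be
  bounded by the least value of the right side, using no more than \<open>exp 1 \<le> 3\<close>.
\<close>

lemma peeling_bound_large_exponent:
  fixes e T L p :: real
  assumes e: "1 / 4 \<le> e" "e \<le> 1" and T: "0 \<le> T" and L: "0 \<le> L"
    and p: "p \<le> (1 + L / (e * (1 / (2 * e)))) * exp (- (exp (1 - e - 1 / (2 * e)) * T))"
  shows "p \<le> (1 + 2 * L) * exp (- (T * (e / (1 + e))))"
proof -
  define z where "z = 1 / e"
  have z: "1 \<le> z" "z \<le> 4" "e = 1 / z" using e by (auto simp: z_def field_simps)
  have e1: "exp (1 :: real) \<le> 3" using exp_le by simp
  have "exp (z / 2 + 1 / z - 1) \<le> 1 + z"
  proof -
    consider "z \<le> 2" | "2 < z" "z \<le> 3" | "3 < z" by linarith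
    then show ?thesis
    proof cases
      case 1
      have "0 \<le> (2 - z) * (z - 1)" using z 1 by simp
      then have "z / 2 + 1 / z - 1 \<le> 1 / 2" using z by (simp add: field_simps)
      then have "exp (z / 2 + 1 / z - 1) \<le> exp (1 / 2)" by simp
      moreover have "(exp (1 / 2) :: real)\<^sup>2 \<le> 2\<^sup>2" using e1 by (simp flip: exp_double)
      then have "exp (1 / 2 :: real) \<le> 2" by (rule power2_le_imp_le) simp
      ultimately show ?thesis using z by linarith
    next
      case 2
      have "1 / z \<le> 1 / 2" using 2 by (simp add: field_simps)
      then have "z / 2 + 1 / z - 1 \<le> 1" using 2 by linarith
      then have "exp (z / 2 + 1 / z - 1) \<le> exp 1" by simp
      then show ?thesis using e1 2 by linarith
    next
      case 3
      have "0 \<le> (4 - z) * (2 * z - 1)" using z 3 by simp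
      then have "z / 2 + 1 / z - 1 \<le> 5 / 4" using z by (simp add: field_simps)
      then have "exp (z / 2 + 1 / z - 1) \<le> exp (5 / 4)" by simp
      moreover have "(exp (5 / 4) :: real) ^ 4 = exp 1 ^ 5" by (simp flip: exp_of_nat_mult)
      then have "(exp (5 / 4) :: real) ^ 4 \<le> 4 ^ 4"
        using power_mono[OF e1, of 5] by simp
      then have "exp (5 / 4 :: real) \<le> 4" by (rule power_le_imp_le_base[of _ 3, simplified]) simp_all
      ultimately show ?thesis using 3 by linarith
    qed
  qed
  then have "inverse (1 + z) \<le> inverse (exp (z / 2 + 1 / z - 1))"
    by (rule le_imp_inverse_le) simp
  also have "\<dots> = exp (- (z / 2 + 1 / z - 1))" by (simp only: exp_minus)
  also have "- (z / 2 + 1 / z - 1) = 1 - e - 1 / (2 * e)" by (simp add: z_def)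
  finally have "1 / (1 + z) \<le> exp (1 - e - 1 / (2 * e))" by (simp add: inverse_eq_divide)
  moreover have "1 / (1 + z) = e / (1 + e)" using e by (simp add: z_def field_simps)
  ultimately have "e / (1 + e) \<le> exp (1 - e - 1 / (2 * e))" by simp
  then have "(e / (1 + e)) * T \<le> exp (1 - e - 1 / (2 * e)) * T" using T by (intro mult_right_mono)
  then have "exp (- (exp (1 - e - 1 / (2 * e)) * T)) \<le> exp (- (T * (e / (1 + e))))"
    by (simp add: mult.commute)
  then have "(1 + 2 * L) * exp (- (exp (1 - e - 1 / (2 * e)) * T)) \<le> (1 + 2 * L) * exp (- (T * (e / (1 + e))))"
    using L by (intro mult_left_mono) auto
  moreover have "L / (e * (1 / (2 * e))) = 2 * L" using e by simp
  ultimately show ?thesis using p by simp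
qed

theorem theorem2p5:
  fixes P :: "'a measure"
    and n :: nat
    and F :: "nat \<Rightarrow> 'a measure"
    and \<xi> :: "nat \<Rightarrow> 'a \<Rightarrow> real"
    and \<beta> b M x :: real
  assumes "prob_space P"
    and "n \<ge> 1"
    and "martingale_differences P n F \<xi>"
    and "sets (F 0) = {{}, space P}"
    and "\<And>\<omega>. \<omega> \<in> space P \<Longrightarrow> \<xi> 0 \<omega> = 0"
    and "1 < \<beta>" and "\<beta> < 2"
    and "\<And>i. i \<le> n \<Longrightarrow> integrable P (\<lambda>\<omega>. \<bar>\<xi> i \<omega>\<bar> powr \<beta>)"
    and "b > 0" and "M \<ge> 1" and "x > 0"
  shows "measure P {\<omega> \<in> space P.
             partial_sum n \<xi> \<omega> / (G_stat P n F \<xi> \<beta> \<omega>) powr (1 / \<beta>) \<ge> x \<and>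
             b powr (1 / (\<beta> - 1)) \<le> (G_stat P n F \<xi> \<beta> \<omega>) powr (1 / \<beta>) \<and>
             (G_stat P n F \<xi> \<beta> \<omega>) powr (1 / \<beta>) \<le> (b * M) powr (1 / (\<beta> - 1))}
         \<le> (1 + 2 * (1 + x) * ln M)
            * exp (- ((x / \<beta>) powr (\<beta> / (\<beta> - 1)) * (1 - 1 / \<beta>)))"
proof -
  interpret prob_space P by fact
  let ?p = "measure P {\<omega> \<in> space P.
             partial_sum n \<xi> \<omega> / (G_stat P n F \<xi> \<beta> \<omega>) powr (1 / \<beta>) \<ge> x \<and>
             b powr (1 / (\<beta> - 1)) \<le> (G_stat P n F \<xi> \<beta> \<omega>) powr (1 / \<beta>) \<and>
             (G_stat P n F \<xi> \<beta> \<omega>) powr (1 / \<beta>) \<le> (b * M) powr (1 / (\<beta> - 1))}"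
  define e where "e = \<beta> - 1"
  define T where "T = (x / \<beta>) powr (\<beta> / (\<beta> - 1))"
  have e: "0 < e" "e < 1" "\<beta> = 1 + e" using assms(6,7) by (auto simp: e_def)
  have L: "0 \<le> ln M" using assms(10) by simp
  have T: "0 \<le> T" by (simp add: T_def)
  have peel: "?p \<le> (1 + ln M / (e * s)) * exp (- (exp (1 - e - s) * T))" if "0 < s" for s
    using self_normalized_tail_peeling[OF assms(1,3,8,6,7,9,10,11) that]
    by (simp add: e_def T_def algebra_simps)
  have "?p \<le> (1 + 2 * ln M) * exp (- (T * (e / (1 + e))))"
  proof (cases "e \<le> 1 / 4")
    case True
    show ?thesis
      by (rule peeling_bound_small_exponent[OF e(1) True T L])
         (use peel[of "1 - e"] e in auto)
  next
    case False
    show ?thesis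
      by (rule peeling_bound_large_exponent[OF _ _ T L])
         (use False e peel[of "1 / (2 * e)"] in auto)
  qed
  also have "\<dots> \<le> (1 + 2 * (1 + x) * ln M) * exp (- (T * (e / (1 + e))))"
    using L assms(11) by (intro mult_right_mono) (auto simp: algebra_simps)
  also have "e / (1 + e) = 1 - 1 / \<beta>" using e by (simp add: field_simps)
  finally show ?thesis by (simp add: T_def)
qed

end
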